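(* Let $n\ge3$ and let $\mathcal{G}$ be the directed line graph on nodes $\{1,\dots,n\}$ with edges $(i,i+1)$ and $(i+1,i)$ for $i=1,\dots,n-1$ together with self-loops $(i,i)$ at every node, and let $\tau\in\mathbb{Z}$ with $n-1\le\tau\le 2n-3$. Suppose the problem of maximizing $\min_{i,j}\mathbb{P}(T_{ij}(P)\le\tau)$ over all Markov chain strategies $P$ conforming to $\mathcal{G}$ has a unique optimal solution. Then this optimal solution is the matrix $P^*$ with $P^*(1,2)=1$, $P^*(n,n-1)=1$, $P^*(i,i-1)=P^*(i,i+1)=\frac12$ for $i=2,\dots,n-1$, and all other entries $0$.
   Context: A Markov chain strategy conforming to $\mathcal{G}=(V,\mathcal{E})$ is a row-stochastic nonnegative $P=(p_{ij})$ with $p_{ij}=0$ for $(i,j)\notin\mathcal{E}$. For the Markov chain $(X_k)$ with transition matrix $P$, $T_{ij}=\min\{k\ge1:X_k=j\}$ given $X_0=i$. *)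

theory Defs
  imports Complex_Main
begin

definition line_edge :: "nat \<Rightarrow> nat \<Rightarrow> nat \<Rightarrow> bool" where
  "line_edge n i j \<longleftrightarrow> i \<in> {1..n} \<and> j \<in> {1..n} \<and> (j = i \<or> j = i + 1 \<or> i = j + 1)"

text \<open>Markov chain strategy conforming to the graph; entries outside the node set are fixed to 0
  (so that a matrix is identified with a function nat => nat => real).\<close>
definition conforming :: "nat \<Rightarrow> (nat \<Rightarrow> nat \<Rightarrow> real) \<Rightarrow> bool" where
  "conforming n P \<longleftrightarrow>
     (\<forall>i j. P i j \<ge> 0) \<and>
     (\<forall>i\<in>{1..n}. (\<Sum>j\<in>{1..n}. P i j) = 1) \<and>
     (\<forall>i j. \<not> line_edge n i j \<longrightarrow> P i j = 0)"

text \<open>hit_le n P k i j = Prob(T_ij <= k) for the chain started at X_0 = i, where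
  T_ij = min {k >= 1. X_k = j} (first-step decomposition).\<close>
fun hit_le :: "nat \<Rightarrow> (nat \<Rightarrow> nat \<Rightarrow> real) \<Rightarrow> nat \<Rightarrow> nat \<Rightarrow> nat \<Rightarrow> real" where
  "hit_le n P 0 i j = 0"
| "hit_le n P (Suc k) i j = (\<Sum>l\<in>{1..n}. P i l * (if l = j then 1 else hit_le n P k l j))"

definition objective :: "nat \<Rightarrow> nat \<Rightarrow> (nat \<Rightarrow> nat \<Rightarrow> real) \<Rightarrow> real" where
  "objective n \<tau> P = Min {hit_le n P \<tau> i j | i j. i \<in> {1..n} \<and> j \<in> {1..n}}"

definition optimal :: "nat \<Rightarrow> nat \<Rightarrow> (nat \<Rightarrow> nat \<Rightarrow> real) \<Rightarrow> bool" where
  "optimal n \<tau> P \<longleftrightarrow> conforming n P \<and>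
     (\<forall>Q. conforming n Q \<longrightarrow> objective n \<tau> Q \<le> objective n \<tau> P)"

definition Pstar :: "nat \<Rightarrow> nat \<Rightarrow> nat \<Rightarrow> real" where
  "Pstar n i j =
     (if i = 1 \<and> j = 2 then 1
      else if i = n \<and> j = n - 1 then 1
      else if 2 \<le> i \<and> i \<le> n - 1 \<and> (j = i - 1 \<or> j = i + 1) then 1/2
      else 0)"

end

theory Submission
  imports Defs "HOL-Computational_Algebra.Formal_Power_Series"
begin

text \<open>The objective is the minimum of the two end-to-end probabilities: every other hitting
  time is dominated by one of the two traversals. A unique optimum is a fixed point of every
  transformation that does not decrease this minimum. Passing to the jump chain is one,
  so there are no self-loops. Reflecting the line is another and gives \<open>P i (i + 1) = P j (j - 1)\<close>
  for \<open>j = n + 1 - i\<close>. The third reverses the order of the interior rows and gives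
  \<open>P i (i + 1) = P j (j + 1)\<close>; it preserves the law of the traversal time because the
  generating function of that law is a monomial times the product of the right-step probabilities,
  divided by an entry of a product of 2 by 2 transfer matrices, all of them self-adjoint for one symmetric
  bilinear form. Together these force all interior probabilities to be 1/2.\<close>

section \<open>Conforming matrices as tridiagonal stochastic matrices\<close>

lemma conforming_nonneg: "conforming n P \<Longrightarrow> 0 \<le> P i j"
  by (simp add: conforming_def)

lemma conforming_zero: "conforming n P \<Longrightarrow> \<not> line_edge n i j \<Longrightarrow> P i j = 0"
  by (simp add: conforming_def)

lemma conforming_row_sum: "conforming n P \<Longrightarrow> i \<in> {1..n} \<Longrightarrow> (\<Sum>j\<in>{1..n}. P i j) = 1"
  by (simp add: conforming_def)

text \<open>The end rows fit the same formula: for \<open>i = 1\<close> or \<open>i = n\<close> one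
  of the three indices is 0 or \<open>n + 1\<close>, off the graph, where \<open>a\<close>
  vanishes.\<close>

lemma sum_neighbours:
  fixes a :: "nat \<Rightarrow> real"
  assumes "i \<in> {1..n}" "\<And>l. \<not> line_edge n i l \<Longrightarrow> a l = 0"
  shows "(\<Sum>l\<in>{1..n}. a l) = a (i - 1) + a i + a (i + 1)"
proof -
  have "(\<Sum>l\<in>{1..n}. a l) = (\<Sum>l\<in>{i - 1, i, i + 1}. a l)"
  proof (rule sum.mono_neutral_cong)
    show "a l = 0" if "l \<in> {i - 1, i, i + 1} - {1..n}" for l
      using that by (intro assms(2)) (auto simp: line_edge_def)
    show "a l = 0" if "l \<in> {1..n} - {i - 1, i, i + 1}" for l
      using that by (intro assms(2)) (auto simp: line_edge_def)
  qed auto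
  moreover have "i - 1 \<noteq> i" "i - 1 \<noteq> i + 1"
    using assms(1) by auto
  ultimately show ?thesis by simp
qed

lemma conforming_sum_neighbours:
  assumes "conforming n P" "i \<in> {1..n}"
  shows "(\<Sum>l\<in>{1..n}. P i l * f l)
    = P i (i - 1) * f (i - 1) + P i i * f i + P i (i + 1) * f (i + 1)"
  by (intro sum_neighbours assms(2)) (simp add: conforming_zero[OF assms(1)])

lemma conforming_neighbour_sum:
  assumes "conforming n P" "i \<in> {1..n}"
  shows "P i (i - 1) + P i i + P i (i + 1) = 1"
  using conforming_sum_neighbours[OF assms, of "\<lambda>_. 1"] conforming_row_sum[OF assms] by simp

lemma conformingI:
  assumes "\<And>i j. 0 \<le> P i j"
    and "\<And>i j. \<not> line_edge n i j \<Longrightarrow> P i j = 0"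
    and "\<And>i. i \<in> {1..n} \<Longrightarrow> P i (i - 1) + P i i + P i (i + 1) = 1"
  shows "conforming n P"
  unfolding conforming_def using assms sum_neighbours[of _ n "P _"] by simp

section \<open>Monotonicity of hitting probabilities\<close>

text \<open>Unlike \<open>hit_le\<close>, this counts a visit at time 0; it is the quantity averaged
  over the first step in \<open>hit_le.simps\<close>.\<close>

abbreviation reach_le :: "nat \<Rightarrow> (nat \<Rightarrow> nat \<Rightarrow> real) \<Rightarrow> nat \<Rightarrow> nat \<Rightarrow> nat \<Rightarrow> real" where
  "reach_le n P k i j \<equiv> (if i = j then 1 else hit_le n P k i j)"

lemma hit_le_nonneg: "conforming n P \<Longrightarrow> 0 \<le> hit_le n P k i j"
  by (induction k arbitrary: i) (auto intro!: sum_nonneg mult_nonneg_nonneg simp: conforming_nonneg)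

lemma hit_le_Suc_le:
  assumes "conforming n P" "i \<in> {1..n}"
    and "\<And>l. l \<in> {1..n} \<Longrightarrow> line_edge n i l \<Longrightarrow> reach_le n P k l j \<le> c"
  shows "hit_le n P (Suc k) i j \<le> c"
proof -
  have "hit_le n P (Suc k) i j \<le> (\<Sum>l\<in>{1..n}. P i l * c)"
    unfolding hit_le.simps
  proof (rule sum_mono)
    fix l assume "l \<in> {1..n}"
    then show "P i l * reach_le n P k l j \<le> P i l * c"
      by (cases "line_edge n i l")
        (simp_all only: mult_left_mono assms(3) conforming_nonneg[OF assms(1)]
          conforming_zero[OF assms(1)] mult_zero_left order_refl not_False_eq_True simp_thms)
  qed
  also have "\<dots> = c"
    using conforming_row_sum[OF assms(1,2)] by (simp flip: sum_distrib_right)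
  finally show ?thesis .
qed

lemma hit_le_Suc_ge:
  assumes "conforming n P" "i \<in> {1..n}"
    and "\<And>l. l \<in> {1..n} \<Longrightarrow> line_edge n i l \<Longrightarrow> c \<le> reach_le n P k l j"
  shows "c \<le> hit_le n P (Suc k) i j"
proof -
  have "c = (\<Sum>l\<in>{1..n}. P i l * c)"
    using conforming_row_sum[OF assms(1,2)] by (simp flip: sum_distrib_right)
  also have "\<dots> \<le> hit_le n P (Suc k) i j"
    unfolding hit_le.simps
  proof (rule sum_mono)
    fix l assume "l \<in> {1..n}"
    then show "P i l * c \<le> P i l * reach_le n P k l j"
      by (cases "line_edge n i l")
        (simp_all only: mult_left_mono assms(3) conforming_nonneg[OF assms(1)]
          conforming_zero[OF assms(1)] mult_zero_left order_refl not_False_eq_True simp_thms)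
  qed
  finally show ?thesis .
qed

lemma hit_le_Suc_mono:
  assumes "conforming n P"
    and "\<And>l. l \<in> {1..n} \<Longrightarrow> line_edge n i l \<Longrightarrow> reach_le n P k l j \<le> reach_le n P m l j'"
  shows "hit_le n P (Suc k) i j \<le> hit_le n P (Suc m) i j'"
  unfolding hit_le.simps
proof (rule sum_mono)
  fix l assume "l \<in> {1..n}"
  then show "P i l * reach_le n P k l j \<le> P i l * reach_le n P m l j'"
    by (cases "line_edge n i l")
      (simp_all only: mult_left_mono assms(2) conforming_nonneg[OF assms(1)]
        conforming_zero[OF assms(1)] mult_zero_left order_refl not_False_eq_True simp_thms)
qed

lemma hit_le_le_1:
  assumes "conforming n P" "i \<in> {1..n}"
  shows "hit_le n P k i j \<le> 1"
  using assms(2)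
proof (induction k arbitrary: i)
  case (Suc k)
  then show ?case by (intro hit_le_Suc_le assms(1)) auto
qed simp

lemma hit_le_mono_time:
  assumes "conforming n P"
  shows "hit_le n P k i j \<le> hit_le n P (Suc k) i j"
proof (induction k arbitrary: i)
  case 0
  then show ?case using hit_le_nonneg[OF assms, of 1] by simp
next
  case (Suc k)
  then show ?case by (intro hit_le_Suc_mono[OF assms]) (auto simp del: hit_le.simps)
qed

text \<open>The walk moves by at most one node per step, so it cannot reach \<open>m\<close> without
  first visiting \<open>j\<close>.\<close>

lemma hit_le_mono_target:
  assumes "conforming n P" "1 \<le> i" "i < j" "j \<le> m" "m \<le> n"
  shows "hit_le n P k i m \<le> hit_le n P k i j"
  using assms(2,3)
proof (induction k arbitrary: i)
  case (Suc k)
  show ?case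
  proof (rule hit_le_Suc_mono[OF assms(1)])
    fix l assume l: "l \<in> {1..n}" "line_edge n i l"
    then have "l \<le> j" using Suc.prems by (auto simp: line_edge_def)
    then show "reach_le n P k l m \<le> reach_le n P k l j"
      using Suc.IH[of l] l hit_le_le_1[OF assms(1), of l k] assms by auto
  qed
qed simp

text \<open>After the visit to \<open>j\<close>, reaching \<open>m\<close> costs at least one
  further step.\<close>

lemma hit_le_Suc_target:
  assumes "conforming n P" "1 \<le> i" "i < j" "j < m" "m \<le> n"
  shows "hit_le n P (Suc k) i m \<le> hit_le n P k i j"
  using assms(2,3)
proof (induction k arbitrary: i)
  case 0
  have "hit_le n P (Suc 0) i m \<le> 0"
    using 0 assms by (intro hit_le_Suc_le) (auto simp: line_edge_def)
  then show ?case by simp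
next
  case (Suc k)
  show ?case
  proof (rule hit_le_Suc_mono[OF assms(1)])
    fix l assume l: "l \<in> {1..n}" "line_edge n i l"
    then have "l \<le> j" using Suc.prems by (auto simp: line_edge_def)
    then show "reach_le n P (Suc k) l m \<le> reach_le n P k l j"
      using Suc.IH[of l] l hit_le_le_1[OF assms(1), of l "Suc k"] assms
      by (auto simp del: hit_le.simps)
  qed
qed

text \<open>From \<open>i < i'\<close> the walk must pass \<open>i'\<close> before \<open>j\<close>.
  In the induction every neighbour of \<open>i\<close> is still at most \<open>i'\<close>, which
  even saves a step.\<close>

lemma hit_le_mono_start:
  assumes "conforming n P" "1 \<le> i" "i \<le> i'" "i' < j" "j \<le> n"
  shows "hit_le n P k i j \<le> hit_le n P k i' j"
  using assms(2-4)
proof (induction k arbitrary: i i')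
  case (Suc k)
  show ?case
  proof (cases "i = i'")
    case False
    have "hit_le n P (Suc k) i j \<le> hit_le n P k i' j"
      using False Suc.prems assms
      by (intro hit_le_Suc_le) (auto simp: line_edge_def intro!: Suc.IH)
    then show ?thesis
      using hit_le_mono_time[OF assms(1), of k i' j] by linarith
  qed simp
qed simp

lemma hit_le_Suc_start:
  assumes "conforming n P" "1 \<le> i" "i < i'" "i' < j" "j \<le> n"
  shows "hit_le n P (Suc k) i j \<le> hit_le n P k i' j"
  using assms by (intro hit_le_Suc_le) (auto simp: line_edge_def intro!: hit_le_mono_start)

lemma hit_le_right_ge:
  assumes "conforming n P" "1 \<le> i" "i < j" "j \<le> n"
  shows "hit_le n P k 1 n \<le> hit_le n P k i j"
  using hit_le_mono_target[OF assms(1), of 1 j n k] hit_le_mono_start[OF assms(1), of 1 i j k] assms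
  by auto

text \<open>Meant for return times, where the first move leaves one step less. Since
  \<open>n >= 3\<close>, one edge is a proper part of the traversal, so a step is saved: before the
  edge if it is the last one, after it otherwise.\<close>

lemma hit_le_right_step_ge:
  assumes "conforming n P" "n \<ge> 3" "1 \<le> i" "i < n"
  shows "hit_le n P (Suc k) 1 n \<le> hit_le n P k i (i + 1)"
proof (cases "i + 1 = n")
  case True
  then show ?thesis
    using hit_le_Suc_start[OF assms(1), of 1 i n k] assms by (auto simp del: hit_le.simps)
next
  case False
  then have "hit_le n P (Suc k) 1 n \<le> hit_le n P k 1 (i + 1)"
    using assms by (intro hit_le_Suc_target) auto
  also have "\<dots> \<le> hit_le n P k i (i + 1)"
    using assms False by (intro hit_le_mono_start) auto
  finally show ?thesis .
qed

section \<open>Reflection of the line\<close>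

text \<open>Truncated subtraction sends indices above \<open>n\<close> to 0, and 0 to
  \<open>n + 1\<close>, so entries off the node set stay off it.\<close>

definition reflect :: "nat \<Rightarrow> (nat \<Rightarrow> nat \<Rightarrow> real) \<Rightarrow> nat \<Rightarrow> nat \<Rightarrow> real" where
  "reflect n P i j = P (n + 1 - i) (n + 1 - j)"

lemma conforming_reflect:
  assumes "conforming n P"
  shows "conforming n (reflect n P)"
proof (rule conformingI)
  show "reflect n P i j = 0" if "\<not> line_edge n i j" for i j
    using that by (auto simp: reflect_def line_edge_def intro!: conforming_zero[OF assms])
  show "reflect n P i (i - 1) + reflect n P i i + reflect n P i (i + 1) = 1" if "i \<in> {1..n}" for i
  proof -
    have "n + 1 - i \<in> {1..n}" "n + 1 - (i - 1) = n + 1 - i + 1" "n + 1 - (i + 1) = n + 1 - i - 1"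
      using that by auto
    then show ?thesis
      using conforming_neighbour_sum[OF assms, of "n + 1 - i"]
      unfolding reflect_def by (simp only:) simp
  qed
qed (simp add: reflect_def conforming_nonneg[OF assms])

lemma hit_le_reflect:
  assumes "i \<in> {1..n}" "j \<in> {1..n}"
  shows "hit_le n (reflect n P) k i j = hit_le n P k (n + 1 - i) (n + 1 - j)"
  using assms(1)
proof (induction k arbitrary: i)
  case (Suc k)
  have "hit_le n (reflect n P) (Suc k) i j
    = (\<Sum>l\<in>{1..n}. P (n + 1 - i) (n + 1 - l) * reach_le n P k (n + 1 - l) (n + 1 - j))"
    unfolding hit_le.simps
  proof (intro sum.cong refl)
    fix l assume l: "l \<in> {1..n}"
    then have "l = j \<longleftrightarrow> n + 1 - l = n + 1 - j" using assms(2) by auto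
    then show "reflect n P i l * reach_le n (reflect n P) k l j
        = P (n + 1 - i) (n + 1 - l) * reach_le n P k (n + 1 - l) (n + 1 - j)"
      using Suc.IH[OF l] by (simp add: reflect_def[of n P i l])
  qed
  also have "\<dots> = (\<Sum>l\<in>{1..n}. P (n + 1 - i) l * reach_le n P k l (n + 1 - j))"
    by (rule sum.reindex_bij_witness[of _ "\<lambda>l. n + 1 - l" "\<lambda>l. n + 1 - l"]) auto
  finally show ?case by (simp only: hit_le.simps)
qed simp

lemma hit_le_reflect_ends:
  assumes "n \<ge> 1"
  shows "hit_le n (reflect n P) k 1 n = hit_le n P k n 1"
  using hit_le_reflect[of 1 n n P k] assms by simp

lemma hit_le_left_ge:
  assumes "conforming n P" "1 \<le> j" "j < i" "i \<le> n"
  shows "hit_le n P k n 1 \<le> hit_le n P k i j"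
  using hit_le_right_ge[OF conforming_reflect[OF assms(1)], of "n + 1 - i" "n + 1 - j" k]
    hit_le_reflect[of "n + 1 - i" n "n + 1 - j" P k] hit_le_reflect_ends[of n P k] assms
  by auto

lemma hit_le_left_step_ge:
  assumes "conforming n P" "n \<ge> 3" "1 \<le> i" "i < n"
  shows "hit_le n P (Suc k) n 1 \<le> hit_le n P k (i + 1) i"
  using hit_le_right_step_ge[OF conforming_reflect[OF assms(1)] assms(2), of "n - i" k]
    hit_le_reflect[of "n - i" n "n - i + 1" P k] hit_le_reflect_ends[of n P "Suc k"] assms
  by (auto simp del: hit_le.simps simp: Suc_diff_le)

section \<open>The objective as the minimum of the two traversals\<close>

lemma objective_eq:
  assumes P: "conforming n P" and n: "n \<ge> 3"
  shows "objective n \<tau> P = min (hit_le n P \<tau> 1 n) (hit_le n P \<tau> n 1)"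
proof -
  let ?S = "{hit_le n P \<tau> i j | i j. i \<in> {1..n} \<and> j \<in> {1..n}}"
  let ?m = "min (hit_le n P \<tau> 1 n) (hit_le n P \<tau> n 1)"
  have fin: "finite ?S" by (rule finite_image_set2) auto
  have "hit_le n P \<tau> 1 n \<in> ?S" "hit_le n P \<tau> n 1 \<in> ?S"
    using n by force+
  then have "?m \<in> ?S" unfolding min_def by presburger
  moreover have "?m \<le> hit_le n P \<tau> i j" if i: "i \<in> {1..n}" and j: "j \<in> {1..n}" for i j
  proof -
    consider "i < j" | "j < i" | "i = j" by linarith
    then show ?thesis
    proof cases
      case 1
      then show ?thesis using hit_le_right_ge[OF P, of i j \<tau>] i j by auto
    next
      case 2
      then show ?thesis using hit_le_left_ge[OF P, of j i \<tau>] i j by auto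
    next
      case 3
      show ?thesis
      proof (cases \<tau>)
        case (Suc k)
        \<comment> \<open>Return times are split by the first step: a self-loop returns at once, and
          from a neighbour a single edge must be crossed within \<open>k\<close> steps.\<close>
        have "?m \<le> reach_le n P k l j" if l: "l \<in> {1..n}" "line_edge n i l" for l
        proof -
          have "?m \<le> 1" using hit_le_le_1[OF P, of 1 \<tau> n] n by auto
          moreover have "?m \<le> hit_le n P k l j" if "l + 1 = j"
            using hit_le_right_step_ge[OF P n, of l k] that l j Suc by (auto simp del: hit_le.simps)
          moreover have "?m \<le> hit_le n P k l j" if "l = j + 1"
            using hit_le_left_step_ge[OF P n, of j k] that l j Suc by (auto simp del: hit_le.simps)
          ultimately show ?thesis using l 3 by (auto simp: line_edge_def)
        qed
        then show ?thesis
          unfolding Suc using hit_le_Suc_ge[OF P i] Suc by metis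
      qed simp
    qed
  qed
  ultimately show ?thesis
    unfolding objective_def using fin by (intro Min_eqI) auto
qed

section \<open>Removing self-loops\<close>

lemma conforming_Pstar:
  assumes "n \<ge> 3"
  shows "conforming n (Pstar n)"
  using assms by (intro conformingI) (auto simp: Pstar_def line_edge_def split: if_splits)

definition loop_free :: "(nat \<Rightarrow> nat \<Rightarrow> real) \<Rightarrow> bool" where
  "loop_free P \<longleftrightarrow> (\<forall>i. P i i = 0)"

text \<open>The jump chain. An absorbing row cannot be normalised; any loop-free row serves instead.\<close>
definition jump :: "nat \<Rightarrow> (nat \<Rightarrow> nat \<Rightarrow> real) \<Rightarrow> nat \<Rightarrow> nat \<Rightarrow> real" where
  "jump n P i j = (if P i i = 1 then Pstar n i j else if j = i then 0 else P i j / (1 - P i i))"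

lemma conforming_loop_le_1:
  assumes "conforming n P"
  shows "P i i \<le> 1"
proof (cases "i \<in> {1..n}")
  case True
  then show ?thesis
    using conforming_neighbour_sum[OF assms True] conforming_nonneg[OF assms, of i "i - 1"]
      conforming_nonneg[OF assms, of i "i + 1"] by linarith
next
  case False
  then show ?thesis using conforming_zero[OF assms, of i i] by (auto simp: line_edge_def)
qed

lemma loop_free_jump:
  assumes "n \<ge> 3"
  shows "loop_free (jump n P)"
  using assms by (auto simp: loop_free_def jump_def Pstar_def)

lemma conforming_jump:
  assumes P: "conforming n P" and n: "n \<ge> 3"
  shows "conforming n (jump n P)"
proof (rule conformingI)
  show "0 \<le> jump n P i j" for i j
    using conforming_nonneg[OF P, of i j] conforming_loop_le_1[OF P, of i]
      conforming_nonneg[OF conforming_Pstar[OF n], of i j]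
    by (auto simp: jump_def)
  show "jump n P i j = 0" if "\<not> line_edge n i j" for i j
    using conforming_zero[OF P that] conforming_zero[OF conforming_Pstar[OF n] that]
    by (auto simp: jump_def)
  show "jump n P i (i - 1) + jump n P i i + jump n P i (i + 1) = 1" if i: "i \<in> {1..n}" for i
  proof (cases "P i i = 1")
    case True
    then show ?thesis
      using conforming_neighbour_sum[OF conforming_Pstar[OF n] i] by (simp add: jump_def)
  next
    case False
    then show ?thesis
      using conforming_neighbour_sum[OF P i] i
      by (auto simp: jump_def simp flip: add_divide_distrib)
  qed
qed

text \<open>Deleting holding times can only make the chain arrive earlier. For \<open>i = j\<close>
  this would fail, because a self-loop is itself a return at time 1.\<close>

lemma hit_le_jump_ge:
  assumes P: "conforming n P" and n: "n \<ge> 3" and "i \<in> {1..n}" "i \<noteq> j"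
  shows "hit_le n P k i j \<le> hit_le n (jump n P) k i j"
  using assms(3,4)
proof (induction k arbitrary: i)
  case (Suc k)
  note i = Suc.prems(1)
  define f where "f l = reach_le n P k l j" for l
  define g where "g l = reach_le n (jump n P) k l j" for l
  have hP: "hit_le n P (Suc k) i j = P i (i - 1) * f (i - 1) + P i i * f i + P i (i + 1) * f (i + 1)"
    unfolding hit_le.simps using conforming_sum_neighbours[OF P i, of f] by (simp add: f_def)
  show ?case
  proof (cases "P i i = 1")
    case True
    have row: "P i (i - 1) = 0" "P i (i + 1) = 0"
      using conforming_neighbour_sum[OF P i] True conforming_nonneg[OF P, of i "i - 1"]
        conforming_nonneg[OF P, of i "i + 1"] by linarith+
    \<comment> \<open>An absorbed walk never reaches \<open>j\<close>, so any replacement row is at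
      least as good.\<close>
    have "hit_le n P m i j = 0" for m
    proof (induction m)
      case (Suc m)
      then show ?case
        unfolding hit_le.simps conforming_sum_neighbours[OF P i] row
        using \<open>i \<noteq> j\<close> by simp
    qed simp
    then show ?thesis
      using hit_le_nonneg[OF conforming_jump[OF P n]] by metis
  next
    case False
    then have pos: "0 < 1 - P i i" using conforming_loop_le_1[OF P, of i] by simp
    have "P i l * f l \<le> P i l * g l" for l
    proof (cases "l \<in> {1..n}")
      case True
      then have "f l \<le> g l" using Suc.IH[of l] by (auto simp: f_def g_def)
      then show ?thesis using conforming_nonneg[OF P] by (intro mult_left_mono)
    next
      case False
      then show ?thesis using conforming_zero[OF P, of i l] by (auto simp: line_edge_def)
    qed
    note fg = this[of "i - 1"] this[of "i + 1"]
    \<comment> \<open>Extending the horizon in the self-loop term puts the same unknown on both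
      sides; solving for it produces the normalised row of \<open>jump\<close>.\<close>
    have "P i i * f i \<le> P i i * hit_le n P (Suc k) i j"
      using hit_le_mono_time[OF P, of k i j] conforming_nonneg[OF P] Suc.prems
      by (intro mult_left_mono) (auto simp: f_def)
    then have "hit_le n P (Suc k) i j * (1 - P i i) \<le> P i (i - 1) * g (i - 1) + P i (i + 1) * g (i + 1)"
      using hP fg by (simp add: algebra_simps del: hit_le.simps)
    then have "hit_le n P (Suc k) i j
        \<le> (P i (i - 1) * g (i - 1) + P i (i + 1) * g (i + 1)) / (1 - P i i)"
      using pos by (simp add: pos_le_divide_eq)
    also have "\<dots> = jump n P i (i - 1) * g (i - 1) + jump n P i i * g i + jump n P i (i + 1) * g (i + 1)"
      using False i by (auto simp: jump_def add_divide_distrib)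
    also have "\<dots> = hit_le n (jump n P) (Suc k) i j"
      unfolding hit_le.simps using conforming_sum_neighbours[OF conforming_jump[OF P n] i, of g]
      by (simp add: g_def)
    finally show ?thesis .
  qed
qed simp

section \<open>Reversal symmetry of first-passage times\<close>

text \<open>Iterating \<^term>\<open>first_passage_step\<close> over the right-step probabilities yields the denominator
  of the generating function of the first-passage time, with \<^term>\<open>x\<close> the square of the formal variable.\<close>
definition first_passage_step :: "'a::comm_ring_1 \<Rightarrow> 'a \<Rightarrow> 'a \<times> 'a \<Rightarrow> 'a \<times> 'a" where
  "first_passage_step x p v = (fst v - x * (1 - p) * snd v, p * fst v)"

text \<open>Every step is self-adjoint for the symmetric bilinear form with matrix
  (1, -x; -x, x), which sends the initial vector (1, 1) to (1 - x) times the first coordinate.\<close>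
lemma first_passage_fold_rev:
  fixes x :: "'a::idom"
  assumes "x \<noteq> 1"
  shows "fst (fold (first_passage_step x) (rev ps) (1, 1)) = fst (fold (first_passage_step x) ps (1, 1))"
proof -
  define B :: "'a \<times> 'a \<Rightarrow> 'a \<times> 'a \<Rightarrow> 'a" where
    "B u v = fst u * fst v - x * fst u * snd v - x * snd u * fst v + x * snd u * snd v" for u v
  have adj: "B (first_passage_step x p u) v = B u (first_passage_step x p v)" for p u v
    by (simp add: B_def first_passage_step_def algebra_simps)
  \<comment> \<open>Moving the steps across the form one at a time reverses their order.\<close>
  have "B (fold (first_passage_step x) ps u) v = B u (fold (first_passage_step x) (rev ps) v)" for u v
    by (induction ps arbitrary: u) (simp_all add: adj)
  from this[of "(1, 1)" "(1, 1)"]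
  have "(1 - x) * fst (fold (first_passage_step x) ps (1, 1))
      = (1 - x) * fst (fold (first_passage_step x) (rev ps) (1, 1))"
    by (simp add: B_def algebra_simps)
  then show ?thesis using assms by simp
qed

text \<open>A step changes the first coordinate by a multiple of X^2 only, so its constant
  coefficient stays 1. This allows the denominator to be cancelled.\<close>

lemma fst_first_passage_fold_nonzero:
  fixes ps :: "'a::comm_ring_1 fps list"
  shows "fst (fold (first_passage_step (fps_X ^ 2)) ps (1, 1)) \<noteq> 0"
proof -
  have "fps_nth (fst (fold (first_passage_step (fps_X ^ 2)) ps v)) 0 = fps_nth (fst v) 0" for v
    by (induction ps arbitrary: v) (auto simp: first_passage_step_def)
  from this[of "(1, 1)"] show ?thesis by auto
qed

text \<open>Left-to-right elimination in the three-term recursion for the generating functions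
  \<open>U i\<close>, clearing denominators so that no division of power series is needed.\<close>

lemma first_passage_fold_mult:
  fixes U p :: "nat \<Rightarrow> 'a::comm_ring_1 fps"
  assumes first: "U 1 = fps_X * U 2"
    and step: "\<And>i. 2 \<le> i \<Longrightarrow> i < n \<Longrightarrow> U i = fps_X * (p i * U (i + 1) + (1 - p i) * U (i - 1))"
    and "2 \<le> m" "m \<le> n"
  defines "v \<equiv> \<lambda>m. fold (first_passage_step (fps_X ^ 2)) (map p [2..<m]) (1, 1)"
  shows "fst (v m) * U 1 = fps_X ^ (m - 1) * prod_list (map p [2..<m]) * U m"
proof -
  \<comment> \<open>The recursion has order two, so the induction must also carry
    \<open>U (m - 1)\<close>, which is tracked by the second coordinate.\<close>
  have "fst (v m) * U 1 = fps_X ^ (m - 1) * prod_list (map p [2..<m]) * U m \<and>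
      snd (v m) * U 1 = fps_X ^ (m - 2) * prod_list (map p [2..<m]) * U (m - 1)"
    using \<open>2 \<le> m\<close> \<open>m \<le> n\<close>
  proof (induction m rule: dec_induct)
    case base
    then show ?case using first by (simp add: v_def)
  next
    case (step m)
    define w where "w = prod_list (map p [2..<m])"
    obtain r where r: "m = r + 2" using step.hyps by (metis add.commute le_Suc_ex)
    have IH: "fst (v m) * U 1 = fps_X ^ (r + 1) * w * U m" "snd (v m) * U 1 = fps_X ^ r * w * U (r + 1)"
      using step.IH step.prems by (auto simp: w_def r)
    \<comment> \<open>The recursion at \<open>m\<close>, solved for its forward term;
      \<open>r = m - 2\<close> avoids truncated subtraction in the exponents.\<close>
    have U: "fps_X * (p m * U (m + 1)) = U m - fps_X * ((1 - p m) * U (r + 1))"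
      using assms(2)[of m] step by (simp add: r algebra_simps)
    have v: "v (Suc m) = first_passage_step (fps_X ^ 2) (p m) (v m)"
      using step.hyps by (simp add: v_def)
    have w: "prod_list (map p [2..<Suc m]) = w * p m"
      using step.hyps by (simp add: w_def)
    have "fst (v (Suc m)) * U 1
        = fst (v m) * U 1 - fps_X ^ 2 * (1 - p m) * (snd (v m) * U 1)"
      by (simp add: v first_passage_step_def algebra_simps)
    also have "\<dots> = fps_X ^ (r + 1) * w * (U m - fps_X * ((1 - p m) * U (r + 1)))"
      unfolding IH by (simp add: algebra_simps power2_eq_square)
    also have "\<dots> = fps_X ^ (Suc m - 1) * (w * p m) * U (Suc m)"
      unfolding U[symmetric] by (simp add: r algebra_simps)
    finally have 1: "fst (v (Suc m)) * U 1 = fps_X ^ (Suc m - 1) * (w * p m) * U (Suc m)" .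
    have "snd (v (Suc m)) * U 1 = p m * (fst (v m) * U 1)"
      by (simp add: v first_passage_step_def algebra_simps)
    also have "\<dots> = fps_X ^ (Suc m - 2) * (w * p m) * U (Suc m - 1)"
      unfolding IH by (simp add: r algebra_simps)
    finally show ?case using 1 unfolding w by blast
  qed
  then show ?thesis ..
qed

section \<open>Traversal times of loop-free strategies\<close>

lemma loop_free_left:
  assumes "conforming n P" "loop_free P" "i \<in> {1..n}"
  shows "P i (i - 1) = 1 - P i (i + 1)"
  using conforming_neighbour_sum[OF assms(1,3)] assms(2) by (simp add: loop_free_def)

lemma loop_free_first:
  assumes "conforming n P" "loop_free P" "n \<ge> 1"
  shows "P 1 2 = 1"
  using loop_free_left[OF assms(1,2), of 1] assms(3) conforming_zero[OF assms(1), of 1 0]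
  by (simp add: line_edge_def numeral_2_eq_2)

lemma loop_free_last:
  assumes "conforming n P" "loop_free P" "n \<ge> 1"
  shows "P n (n - 1) = 1"
  using loop_free_left[OF assms(1,2), of n] assms(3) conforming_zero[OF assms(1), of n "n + 1"]
  by (simp add: line_edge_def)

text \<open>The coefficients are cumulative: for a node \<open>i < n\<close> this is the generating
  function of the first-passage law divided by 1 - X. At \<open>i = n\<close> it is 1/(1 - X) for
  every \<open>P\<close>.\<close>

definition reach_fps :: "nat \<Rightarrow> (nat \<Rightarrow> nat \<Rightarrow> real) \<Rightarrow> nat \<Rightarrow> real fps" where
  "reach_fps n P i = Abs_fps (\<lambda>k. reach_le n P k i n)"

text \<open>The factor X accounts for the first step. For \<open>i = 1\<close> the series at index 0
  occurs with weight \<open>P 1 0 = 0\<close>.\<close>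

lemma reach_fps_rec:
  assumes P: "conforming n P" "loop_free P" and i: "1 \<le> i" "i < n"
  shows "reach_fps n P i = fps_X * (fps_const (P i (i + 1)) * reach_fps n P (i + 1)
    + (1 - fps_const (P i (i + 1))) * reach_fps n P (i - 1))" (is "?l = ?r")
proof (rule fps_ext)
  fix k
  have i': "i \<in> {1..n}" using i by auto
  have c: "1 - fps_const (P i (i + 1)) = fps_const (P i (i - 1))"
    unfolding loop_free_left[OF P i'] by (simp flip: fps_const_1_eq_1 add: fps_const_sub)
  show "fps_nth ?l k = fps_nth ?r k"
  proof (cases k)
    case 0
    then show ?thesis using i by (simp add: reach_fps_def)
  next
    case (Suc m)
    have "hit_le n P (Suc m) i n
        = P i (i - 1) * reach_le n P m (i - 1) n + P i (i + 1) * reach_le n P m (i + 1) n"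
      unfolding hit_le.simps conforming_sum_neighbours[OF P(1) i'] using P(2)
      by (simp add: loop_free_def)
    then show ?thesis
      unfolding c using i Suc by (simp add: reach_fps_def del: hit_le.simps)
  qed
qed

text \<open>The traversal series is determined by a numerator, a product unaffected by order, and a
  denominator, unaffected by reversal. Only rows 2 to \<open>n - 1\<close> enter, as the end rows of
  a loop-free strategy are forced.\<close>

lemma hit_le_reverse_rows:
  assumes P: "conforming n P" "loop_free P" and Q: "conforming n Q" "loop_free Q"
    and n: "n \<ge> 2"
    and PQ: "\<And>i. 2 \<le> i \<Longrightarrow> i < n \<Longrightarrow> Q i (i + 1) = P (n + 1 - i) (n + 2 - i)"
  shows "hit_le n Q k 1 n = hit_le n P k 1 n"
proof -
  define D where "D R = fst (fold (first_passage_step (fps_X ^ 2))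
    (map (\<lambda>i. fps_const (R i (i + 1))) [2..<n]) (1, 1))" for R :: "nat \<Rightarrow> nat \<Rightarrow> real"
  define w where "w R = prod_list (map (\<lambda>i. fps_const (R i (i + 1))) [2..<n])"
    for R :: "nat \<Rightarrow> nat \<Rightarrow> real"
  have D: "D R * reach_fps n R 1 = fps_X ^ (n - 1) * w R * reach_fps n R n"
    if R: "conforming n R" "loop_free R" for R
    unfolding D_def w_def
  proof (rule first_passage_fold_mult[where n = n])
    show "reach_fps n R 1 = fps_X * reach_fps n R 2"
      using reach_fps_rec[OF R, of 1] loop_free_first[OF R] n by (simp add: numeral_2_eq_2)
    show "reach_fps n R i = fps_X * (fps_const (R i (i + 1)) * reach_fps n R (i + 1)
        + (1 - fps_const (R i (i + 1))) * reach_fps n R (i - 1))" if "2 \<le> i" "i < n" for i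
      using reach_fps_rec[OF R, of i] that by simp
  qed (use n in auto)
  have rev: "map (\<lambda>i. fps_const (Q i (i + 1))) [2..<n]
      = rev (map (\<lambda>i. fps_const (P i (i + 1))) [2..<n])"
  proof (rule nth_equalityI)
    fix j assume "j < length (map (\<lambda>i. fps_const (Q i (i + 1))) [2..<n])"
    then have j: "j < n - 2" by simp
    then have "n + 1 - (2 + j) = 2 + (n - 2 - Suc j)" "n + 2 - (2 + j) = 2 + (n - 2 - Suc j) + 1"
      by auto
    moreover have "[2..<n] ! (n - 2 - Suc j) = 2 + (n - 2 - Suc j)"
      using j by (intro nth_upt) auto
    ultimately show "map (\<lambda>i. fps_const (Q i (i + 1))) [2..<n] ! j
        = rev (map (\<lambda>i. fps_const (P i (i + 1))) [2..<n]) ! j"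
      using j PQ[of "2 + j"] by (simp add: rev_nth)
  qed simp
  have "fps_nth (fps_X ^ 2 :: real fps) 0 \<noteq> fps_nth 1 0" by simp
  then have "(fps_X ^ 2 :: real fps) \<noteq> 1" by metis
  then have "D Q = D P"
    unfolding D_def rev by (rule first_passage_fold_rev)
  moreover have "w Q = w P"
    unfolding w_def rev by (simp add: prod_list.rev)
  moreover have "reach_fps n Q n = reach_fps n P n"
    by (simp add: reach_fps_def)
  ultimately have "D P * reach_fps n Q 1 = D P * reach_fps n P 1"
    using D[OF P] D[OF Q] by simp
  moreover have "D P \<noteq> 0"
    unfolding D_def by (rule fst_first_passage_fold_nonzero)
  ultimately have "fps_nth (reach_fps n Q 1) k = fps_nth (reach_fps n P 1) k"
    by simp
  then show ?thesis using n by (simp add: reach_fps_def)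
qed

text \<open>Interior row \<open>i\<close> takes over row \<open>n + 1 - i\<close> with left and
  right kept, whereas \<open>reflect\<close> swaps them.\<close>

definition reverse_rows :: "nat \<Rightarrow> (nat \<Rightarrow> nat \<Rightarrow> real) \<Rightarrow> nat \<Rightarrow> nat \<Rightarrow> real" where
  "reverse_rows n P i j =
    (if i = 1 \<or> i = n then P i j
     else if j = i + 1 then P (n + 1 - i) (n + 2 - i)
     else if i = j + 1 then P (n + 1 - i) (n - i)
     else 0)"

lemma conforming_reverse_rows:
  assumes P: "conforming n P" "loop_free P"
  shows "conforming n (reverse_rows n P)"
proof (rule conformingI)
  show "0 \<le> reverse_rows n P i j" for i j
    by (simp add: reverse_rows_def conforming_nonneg[OF P(1)])
  show "reverse_rows n P i j = 0" if "\<not> line_edge n i j" for i j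
    using that by (auto simp: reverse_rows_def line_edge_def intro!: conforming_zero[OF P(1)])
  show "reverse_rows n P i (i - 1) + reverse_rows n P i i + reverse_rows n P i (i + 1) = 1"
    if i: "i \<in> {1..n}" for i
  proof (cases "i = 1 \<or> i = n")
    case True
    then show ?thesis
      using conforming_neighbour_sum[OF P(1) i] by (simp add: reverse_rows_def)
  next
    case False
    then have "n + 1 - i \<in> {1..n}" "n + 2 - i = n + 1 - i + 1" "n - i = n + 1 - i - 1"
      using i by auto
    then show ?thesis
      using loop_free_left[OF P, of "n + 1 - i"] False i by (auto simp: reverse_rows_def)
  qed
qed

lemma loop_free_reverse_rows: "loop_free P \<Longrightarrow> loop_free (reverse_rows n P)"
  by (auto simp: loop_free_def reverse_rows_def)

lemma loop_free_reflect: "loop_free P \<Longrightarrow> loop_free (reflect n P)"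
  by (simp add: loop_free_def reflect_def)

lemma objective_reverse_rows:
  assumes P: "conforming n P" "loop_free P" and n: "n \<ge> 3"
  shows "objective n \<tau> (reverse_rows n P) = objective n \<tau> P"
proof -
  note Q = conforming_reverse_rows[OF P] loop_free_reverse_rows[OF P(2), of n]
  have "hit_le n (reverse_rows n P) \<tau> 1 n = hit_le n P \<tau> 1 n"
    using n by (intro hit_le_reverse_rows P Q) (auto simp: reverse_rows_def)
  \<comment> \<open>Reflection turns the left traversal into a right one; its right-step
    probabilities are the left-step probabilities of \<open>P\<close>, which
    \<open>reverse_rows\<close> reverses as well.\<close>
  moreover have "hit_le n (reflect n (reverse_rows n P)) \<tau> 1 n = hit_le n (reflect n P) \<tau> 1 n"
  proof (intro hit_le_reverse_rows conforming_reflect loop_free_reflect P Q)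
    fix i assume i: "2 \<le> i" "i < n"
    then have "n + 1 - (n + 1 - i) = i" "n + 1 - (n + 2 - i) = i - 1" by auto
    then show "reflect n (reverse_rows n P) i (i + 1) = reflect n P (n + 1 - i) (n + 2 - i)"
      using i by (auto simp: reflect_def reverse_rows_def)
  qed (use n in auto)
  ultimately show ?thesis
    using n by (simp add: objective_eq[OF P(1)] objective_eq[OF Q(1)] hit_le_reflect_ends del: One_nat_def)
qed

section \<open>The unique optimum as a common fixed point\<close>

theorem theorem3:
  fixes n \<tau> :: nat
  assumes "n \<ge> 3"
    and "n - 1 \<le> \<tau>" and "\<tau> \<le> 2 * n - 3"
    and "\<exists>!P. optimal n \<tau> P"
  shows "\<forall>P. optimal n \<tau> P \<longrightarrow> P = Pstar n"
proof (intro allI impI)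
  fix P assume opt: "optimal n \<tau> P"
  then have P: "conforming n P" by (simp add: optimal_def)
  have unique: "Q = P" if "conforming n Q" "objective n \<tau> P \<le> objective n \<tau> Q" for Q
  proof -
    have "optimal n \<tau> Q"
      using that opt unfolding optimal_def by (meson order_trans)
    then show ?thesis using opt assms(4) by blast
  qed
  have "jump n P = P"
  proof (rule unique)
    show "objective n \<tau> P \<le> objective n \<tau> (jump n P)"
      using hit_le_jump_ge[OF P \<open>n \<ge> 3\<close>, of 1 n \<tau>] hit_le_jump_ge[OF P \<open>n \<ge> 3\<close>, of n 1 \<tau>] \<open>n \<ge> 3\<close>
      by (auto simp: objective_eq P conforming_jump min_def)
  qed (use P \<open>n \<ge> 3\<close> conforming_jump in auto)
  then have free: "loop_free P" using loop_free_jump[OF \<open>n \<ge> 3\<close>, of P] by simp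
  have "hit_le n (reflect n P) \<tau> n 1 = hit_le n P \<tau> 1 n"
    using hit_le_reflect[of n n 1 P \<tau>] \<open>n \<ge> 3\<close> by simp
  then have refl: "reflect n P = P"
    using \<open>n \<ge> 3\<close> P
    by (intro unique) (auto simp: conforming_reflect objective_eq hit_le_reflect_ends simp del: One_nat_def)
  have rev: "reverse_rows n P = P"
    using P free \<open>n \<ge> 3\<close>
    by (intro unique) (auto simp: conforming_reverse_rows objective_reverse_rows)
  have half: "P i (i + 1) = 1/2" "P i (i - 1) = 1/2" if i: "2 \<le> i" "i \<le> n - 1" for i
  proof -
    \<comment> \<open>Row reversal moves the right-step probability to the mirror row; reflection
      brings it back as the left-step probability of row \<open>i\<close>.\<close>
    have "P i (i + 1) = reverse_rows n P i (i + 1)" by (simp add: rev)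
    also have "\<dots> = P (n + 1 - i) (n + 2 - i)" using i by (auto simp: reverse_rows_def)
    also have "\<dots> = reflect n P i (i - 1)"
      using i \<open>n \<ge> 3\<close> by (simp add: reflect_def numeral_2_eq_2)
    finally have "P i (i + 1) = P i (i - 1)" by (simp add: refl)
    moreover have "P i (i - 1) = 1 - P i (i + 1)"
      using i by (intro loop_free_left[OF P free]) auto
    ultimately show "P i (i + 1) = 1/2" "P i (i - 1) = 1/2" by linarith+
  qed
  show "P = Pstar n"
  proof (intro ext)
    fix i j
    have "i = 1 \<and> j = 2 \<or> i = n \<and> j = n - 1 \<or> 2 \<le> i \<and> i \<le> n - 1 \<and> j = i + 1
      \<or> 2 \<le> i \<and> i \<le> n - 1 \<and> j = i - 1 \<or> i = j \<or> \<not> line_edge n i j"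
      unfolding line_edge_def atLeastAtMost_iff by presburger
    then consider "i = 1" "j = 2" | "i = n" "j = n - 1" | "2 \<le> i" "i \<le> n - 1" "j = i + 1"
      | "2 \<le> i" "i \<le> n - 1" "j = i - 1" | "i = j" | "\<not> line_edge n i j"
      by blast
    then show "P i j = Pstar n i j"
    proof cases
      case 5
      then show ?thesis using free \<open>n \<ge> 3\<close> by (auto simp: loop_free_def Pstar_def)
    next
      case 6
      then show ?thesis
        using conforming_zero[OF P] conforming_zero[OF conforming_Pstar[OF \<open>n \<ge> 3\<close>]] by simp
    qed (use loop_free_first[OF P free] loop_free_last[OF P free] half \<open>n \<ge> 3\<close>
        in \<open>auto simp: Pstar_def\<close>)
  qed
qed

end
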